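(* No online rule always satisfies fixed-rank-wJR. Hence, no online rule always satisfies any of the approval-based axioms, i.e., any of fixed-rank-$X$, rank-$X$, all-rank-$X$ with $X\in\{\text{wJR},\text{JR},\text{wPJR},\text{PJR},\text{wEJR},\text{EJR}\}$.
   Context: Model. Voters $V=[n]$, a set $C$ of $m$ candidates, rounds $T=\{1,\dots,|T|\}$ with $n,m,|T|\ge1$; $|T|$ is the horizon. In each round $j$ each voter $i$ has a strict complete ranking of $C$; $P^j$ denotes the tuple of round-$j$ rankings. For $r\in[m]$, $A_i^j(r)$ is the set of voter $i$'s $r$ most-preferred candidates in round $j$. A group is a nonempty $S\subseteq V$. A temporal voting rule maps each input to a sequence $W=(w^1,\dots,w^{|T|})\in C^{|T|}$. It is online if, for every $j$, its choice of $w^j$ depends only on $P^1,\dots,P^j$ (besides $V$ and $C$) and not on the horizon $|T|$. A rule always satisfies an axiom if its output satisfies the axiom for every input. Cutoffs. Fixed-rank: a single $r\in[m]$, voter $i$ approves $A_i^j(r)$ in every round $j$. Rank: a rank vector $\mathbf r\in[m]^{|T|}$, voter $i$ approves $A_i^j(r^j)$. All-rank: a rank matrix $(r_i^j)\in[m]^{|T|\times n}$, voter $i$ approves $A_i^j(r_i^j)$. Under given cutoffs, $S$ agrees in round $j$ if its members approve a common candidate in round $j$, and is represented in round $j$ if some member approves $w^j$. Axioms. For given cutoffs, JR / PJR / EJR require that for every positive integer $\ell$ and every group $S$ that agrees in $k>0$ rounds with $|S|\ge\ell n/k$: (JR) $S$ is represented in at least one round; (PJR) $S$ is represented in at least $\ell$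 rounds; (EJR) some voter $i\in S$ approves the winner in at least $\ell$ rounds. wJR, wPJR, wEJR impose the same only for groups agreeing in every round ($k=|T|$). $W$ satisfies fixed-rank-$X$ (rank-$X$, all-rank-$X$) if it satisfies $X$ for every $r\in[m]$ (every rank vector, every rank matrix). *)

theory Defs
  imports Complex_Main "HOL-Library.FuncSet" "HOL-Combinatorics.Multiset_Permutations"
begin

text \<open>
  The voters are \<open>{1..n}\<close>, the rounds are \<open>{1..T}\<close>, and a strict complete ranking of \<open>C\<close> is a
  list enumerating \<open>C\<close> without repetition, most preferred candidate first. \<open>P j i\<close> is the
  ranking of voter \<open>i\<close> in round \<open>j\<close>, and \<open>W j\<close> is the winner of round \<open>j\<close>.
  Candidates are elements of a type \<open>'c\<close>; a rule takes every finite nonempty \<open>C :: 'c set\<close> as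
  input, so for an infinite \<open>'c\<close> every number of candidates occurs. Profiles are extensional
  functions, so that an input has a unique representation.
\<close>

type_synonym 'c profile = "nat \<Rightarrow> nat \<Rightarrow> 'c list"
type_synonym 'c outcome = "nat \<Rightarrow> 'c"

definition valid_input :: "nat \<Rightarrow> 'c set \<Rightarrow> nat \<Rightarrow> 'c profile \<Rightarrow> bool" where
  "valid_input n C T P \<longleftrightarrow>
     n \<ge> 1 \<and> T \<ge> 1 \<and> finite C \<and> C \<noteq> {} \<and>
     P \<in> {1..T} \<rightarrow>\<^sub>E {1..n} \<rightarrow>\<^sub>E permutations_of_set C"

definition top_set :: "'c profile \<Rightarrow> nat \<Rightarrow> nat \<Rightarrow> nat \<Rightarrow> 'c set" where
  "top_set P j i r = set (take r (P j i))"

subsection \<open>Temporal voting rules\<close>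

text \<open>The arguments of a rule are \<open>n\<close>, \<open>C\<close>, the horizon \<open>T\<close> and the profile.\<close>

type_synonym 'c rule = "nat \<Rightarrow> 'c set \<Rightarrow> nat \<Rightarrow> 'c profile \<Rightarrow> 'c outcome"

definition temporal_voting_rule :: "'c rule \<Rightarrow> bool" where
  "temporal_voting_rule f \<longleftrightarrow>
     (\<forall>n C T P. valid_input n C T P \<longrightarrow> f n C T P \<in> {1..T} \<rightarrow> C)"

definition online :: "'c rule \<Rightarrow> bool" where
  "online f \<longleftrightarrow>
     (\<forall>n C T P T' P' j.
        valid_input n C T P \<longrightarrow> valid_input n C T' P' \<longrightarrow> j \<in> {1..T} \<longrightarrow> j \<in> {1..T'} \<longrightarrow>
        (\<forall>j' \<in> {1..j}. P j' = P' j') \<longrightarrow> f n C T P j = f n C T' P' j)"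

subsection \<open>Axioms for given cutoffs\<close>

text \<open>\<open>A j i\<close> is the set of candidates that voter \<open>i\<close> approves in round \<open>j\<close>.\<close>

type_synonym 'c approvals = "nat \<Rightarrow> nat \<Rightarrow> 'c set"

definition group :: "nat \<Rightarrow> nat set \<Rightarrow> bool" where
  "group n S \<longleftrightarrow> S \<noteq> {} \<and> S \<subseteq> {1..n}"

definition agrees :: "'c approvals \<Rightarrow> nat set \<Rightarrow> nat \<Rightarrow> bool" where
  "agrees A S j \<longleftrightarrow> (\<exists>c. \<forall>i\<in>S. c \<in> A j i)"

definition represented :: "'c approvals \<Rightarrow> 'c outcome \<Rightarrow> nat set \<Rightarrow> nat \<Rightarrow> bool" where
  "represented A W S j \<longleftrightarrow> (\<exists>i\<in>S. W j \<in> A j i)"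

text \<open>The guarantee owed to a group \<open>S\<close> that deserves \<open>l\<close> rounds.\<close>

type_synonym 'c guarantee = "nat \<Rightarrow> 'c approvals \<Rightarrow> 'c outcome \<Rightarrow> nat set \<Rightarrow> nat \<Rightarrow> bool"

definition jr_guarantee :: "'c guarantee" where
  "jr_guarantee T A W S l \<longleftrightarrow> (\<exists>j\<in>{1..T}. represented A W S j)"

definition pjr_guarantee :: "'c guarantee" where
  "pjr_guarantee T A W S l \<longleftrightarrow> card {j\<in>{1..T}. represented A W S j} \<ge> l"

definition ejr_guarantee :: "'c guarantee" where
  "ejr_guarantee T A W S l \<longleftrightarrow> (\<exists>i\<in>S. card {j\<in>{1..T}. W j \<in> A j i} \<ge> l)"

type_synonym 'c approval_axiom = "nat \<Rightarrow> nat \<Rightarrow> 'c approvals \<Rightarrow> 'c outcome \<Rightarrow> bool"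

definition strong_axiom :: "'c guarantee \<Rightarrow> 'c approval_axiom" where
  "strong_axiom G n T A W \<longleftrightarrow>
     (\<forall>l k S. l \<ge> 1 \<longrightarrow> group n S \<longrightarrow> k = card {j\<in>{1..T}. agrees A S j} \<longrightarrow> k > 0 \<longrightarrow>
        real (card S) \<ge> real l * real n / real k \<longrightarrow> G T A W S l)"

definition weak_axiom :: "'c guarantee \<Rightarrow> 'c approval_axiom" where
  "weak_axiom G n T A W \<longleftrightarrow>
     (\<forall>l S. l \<ge> 1 \<longrightarrow> group n S \<longrightarrow> (\<forall>j\<in>{1..T}. agrees A S j) \<longrightarrow>
        real (card S) \<ge> real l * real n / real T \<longrightarrow> G T A W S l)"

definition JR :: "'c approval_axiom" where "JR = strong_axiom jr_guarantee"
definition PJR :: "'c approval_axiom" where "PJR = strong_axiom pjr_guarantee"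
definition EJR :: "'c approval_axiom" where "EJR = strong_axiom ejr_guarantee"
definition wJR :: "'c approval_axiom" where "wJR = weak_axiom jr_guarantee"
definition wPJR :: "'c approval_axiom" where "wPJR = weak_axiom pjr_guarantee"
definition wEJR :: "'c approval_axiom" where "wEJR = weak_axiom ejr_guarantee"

subsection \<open>Axioms for ranked preferences\<close>

type_synonym 'c temporal_axiom = "nat \<Rightarrow> 'c set \<Rightarrow> nat \<Rightarrow> 'c profile \<Rightarrow> 'c outcome \<Rightarrow> bool"

definition fixed_rank_axiom :: "'c approval_axiom \<Rightarrow> 'c temporal_axiom" where
  "fixed_rank_axiom X n C T P W \<longleftrightarrow>
     (\<forall>r\<in>{1..card C}. X n T (\<lambda>j i. top_set P j i r) W)"

definition rank_axiom :: "'c approval_axiom \<Rightarrow> 'c temporal_axiom" where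
  "rank_axiom X n C T P W \<longleftrightarrow>
     (\<forall>r \<in> {1..T} \<rightarrow> {1..card C}. X n T (\<lambda>j i. top_set P j i (r j)) W)"

definition all_rank_axiom :: "'c approval_axiom \<Rightarrow> 'c temporal_axiom" where
  "all_rank_axiom X n C T P W \<longleftrightarrow>
     (\<forall>r \<in> {1..T} \<rightarrow> {1..n} \<rightarrow> {1..card C}. X n T (\<lambda>j i. top_set P j i (r j i)) W)"

definition always_satisfies :: "'c rule \<Rightarrow> 'c temporal_axiom \<Rightarrow> bool" where
  "always_satisfies f Y \<longleftrightarrow>
     (\<forall>n C T P. valid_input n C T P \<longrightarrow> Y n C T P (f n C T P))"

end

theory Submission
  imports Defs
begin

text \<open>
  Take four voters and the constant profile in which voter \<open>i\<close> ranks a private candidate \<open>a i\<close>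
  first and a common candidate \<open>a 0\<close> second. At horizon 4 and rank 1 every single voter must be
  represented, so the four winners are exactly the four private candidates. Being online, the rule
  elects the first two of these at horizon 2 as well. There the two voters whose private candidates
  did not win agree on \<open>a 0\<close> at rank 2 and are never represented.
\<close>

lemma jr_guarantee_if_pjr_guarantee:
  assumes "pjr_guarantee T A W S l" "l \<ge> 1"
  shows "jr_guarantee T A W S l"
proof -
  have "card {j\<in>{1..T}. represented A W S j} \<noteq> 0"
    using assms unfolding pjr_guarantee_def by linarith
  then show ?thesis
    unfolding jr_guarantee_def by (metis (mono_tags, lifting) card.empty empty_Collect_eq)
qed

lemma jr_guarantee_if_ejr_guarantee:
  assumes "ejr_guarantee T A W S l" "l \<ge> 1"
  shows "jr_guarantee T A W S l"
proof -
  obtain i where i: "i \<in> S" "card {j\<in>{1..T}. W j \<in> A j i} \<noteq> 0"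
    using assms unfolding ejr_guarantee_def by (metis le_zero_eq not_one_le_zero)
  then show ?thesis
    unfolding jr_guarantee_def represented_def
    by (metis (mono_tags, lifting) card.empty empty_Collect_eq)
qed

text \<open>For a group that agrees in every round, the number \<open>k\<close> of agreement rounds
  is \<open>T\<close>, so both size thresholds coincide.\<close>

lemma weak_axiom_if_strong_axiom:
  assumes "strong_axiom G n T A W" "T \<ge> 1"
  shows "weak_axiom G n T A W"
  unfolding weak_axiom_def
proof (intro allI impI)
  fix l S
  assume l: "l \<ge> 1" and S: "group n S" and agr: "\<forall>j\<in>{1..T}. agrees A S j"
    and size: "real (card S) \<ge> real l * real n / real T"
  have "{j\<in>{1..T}. agrees A S j} = {1..T}"
    using agr by auto
  then have "T = card {j\<in>{1..T}. agrees A S j}"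
    by simp
  moreover have "T > 0"
    using assms(2) by simp
  ultimately show "G T A W S l"
    using assms(1) l S size unfolding strong_axiom_def by blast
qed

lemma weak_axiom_mono:
  assumes "weak_axiom G n T A W" "\<And>S l. G T A W S l \<Longrightarrow> l \<ge> 1 \<Longrightarrow> H T A W S l"
  shows "weak_axiom H n T A W"
  using assms unfolding weak_axiom_def by blast

text \<open>Two reductions combine: strong axioms specialise to weak ones, and for
  \<open>l \<ge> 1\<close> both the PJR and the EJR guarantee provide at least one round in which
  the group is represented.\<close>

lemma wJR_weakest:
  assumes "X \<in> {wJR, JR, wPJR, PJR, wEJR, EJR}" "X n T A W" "T \<ge> 1"
  shows "wJR n T A W"
proof -
  have "weak_axiom G n T A W" if "X = strong_axiom G \<or> X = weak_axiom G" for G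
    using that assms(2,3) weak_axiom_if_strong_axiom by metis
  then have "weak_axiom jr_guarantee n T A W \<or> weak_axiom pjr_guarantee n T A W
      \<or> weak_axiom ejr_guarantee n T A W"
    using assms(1) unfolding JR_def PJR_def EJR_def wJR_def wPJR_def wEJR_def by blast
  then show ?thesis
    unfolding wJR_def
    using weak_axiom_mono jr_guarantee_if_pjr_guarantee jr_guarantee_if_ejr_guarantee by metis
qed

text \<open>A single rank is the special case of a constant rank vector.\<close>

lemma fixed_rank_if_rank:
  "rank_axiom X n C T P W \<Longrightarrow> fixed_rank_axiom X n C T P W"
  unfolding rank_axiom_def fixed_rank_axiom_def
proof
  fix r
  assume "\<forall>r \<in> {1..T} \<rightarrow> {1..card C}. X n T (\<lambda>j i. top_set P j i (r j)) W"
    and "r \<in> {1..card C}"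
  then show "X n T (\<lambda>j i. top_set P j i r) W"
    by (elim ballE[of _ _ "\<lambda>_. r"]) auto
qed

lemma fixed_rank_if_all_rank:
  "all_rank_axiom X n C T P W \<Longrightarrow> fixed_rank_axiom X n C T P W"
  unfolding all_rank_axiom_def fixed_rank_axiom_def
proof
  fix r
  assume "\<forall>r \<in> {1..T} \<rightarrow> {1..n} \<rightarrow> {1..card C}. X n T (\<lambda>j i. top_set P j i (r j i)) W"
    and "r \<in> {1..card C}"
  then show "X n T (\<lambda>j i. top_set P j i r) W"
    by (elim ballE[of _ _ "\<lambda>_ _. r"]) auto
qed

text \<open>This reduces all eighteen impossibilities to a single one.\<close>

lemma fixed_rank_wJR_weakest:
  assumes "R \<in> {fixed_rank_axiom, rank_axiom, all_rank_axiom}"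
    and "X \<in> {wJR, JR, wPJR, PJR, wEJR, EJR}"
    and "R X n C T P W" "T \<ge> 1"
  shows "fixed_rank_axiom wJR n C T P W"
proof -
  have "fixed_rank_axiom X n C T P W"
    using assms(1,3) fixed_rank_if_rank fixed_rank_if_all_rank by blast
  then show ?thesis
    using wJR_weakest[OF assms(2) _ assms(4)] unfolding fixed_rank_axiom_def by blast
qed

text \<open>Only the first two places matter to the argument; the filtered tail merely completes the
  list to an enumeration of \<open>a 0\<close>, ..., \<open>a 4\<close>.\<close>

definition private_ranking :: "(nat \<Rightarrow> 'c) \<Rightarrow> nat \<Rightarrow> 'c list" where
  "private_ranking a i = map a (i # 0 # filter (\<lambda>k. k \<noteq> i) [1..<5])"

text \<open>The horizon enters only through the extensional domain, so profiles for different
  horizons coincide on their common rounds.\<close>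

definition private_profile :: "(nat \<Rightarrow> 'c) \<Rightarrow> nat \<Rightarrow> 'c profile" where
  "private_profile a T = (\<lambda>j\<in>{1..T}. \<lambda>i\<in>{1..4}. private_ranking a i)"

lemma private_ranking_permutation:
  assumes "inj a" "i \<in> {1..4}"
  shows "private_ranking a i \<in> permutations_of_set (a ` {..4})"
proof
  have "set (i # 0 # filter (\<lambda>k. k \<noteq> i) [1..<5]) = {..4}"
    using assms(2) by auto
  then show "set (private_ranking a i) = a ` {..4}"
    unfolding private_ranking_def by (metis set_map)
  have "distinct (i # 0 # filter (\<lambda>k. k \<noteq> i) [1..<5])"
    using assms(2) by auto
  then show "distinct (private_ranking a i)"
    unfolding private_ranking_def
    by (metis distinct_map assms(1) inj_on_subset subset_UNIV)
qed

lemma private_profile_valid: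
  assumes "inj a" "T \<ge> 1"
  shows "valid_input 4 (a ` {..4}) T (private_profile a T)"
  using assms private_ranking_permutation[OF assms(1)]
  unfolding valid_input_def private_profile_def by auto

lemma top_set_private_profile:
  assumes "j \<in> {1..T}" "i \<in> {1..4}"
  shows "top_set (private_profile a T) j i 1 = {a i}"
    and "top_set (private_profile a T) j i 2 = {a i, a 0}"
  using assms by (simp_all add: top_set_def private_profile_def private_ranking_def)

lemma no_online_fixed_rank_wJR:
  fixes f :: "'c rule"
  assumes "infinite (UNIV :: 'c set)" "online f" "always_satisfies f (fixed_rank_axiom wJR)"
  shows False
proof -
  obtain a :: "nat \<Rightarrow> 'c" where a: "inj a"
    using assms(1) infinite_countable_subset by blast
  define C where "C = a ` {..4}"
  define w where "w T = f 4 C T (private_profile a T)" for T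
  have valid: "valid_input 4 C T (private_profile a T)" if "T \<ge> 1" for T
    using private_profile_valid[OF a that] by (simp add: C_def)
  have "card C = 5"
    using a by (simp add: C_def card_image inj_on_subset)
  then have wJR: "wJR 4 T (\<lambda>j i. top_set (private_profile a T) j i r) (w T)"
    if "T \<ge> 1" "r \<in> {1..5}" for T r
    using assms(3) valid[OF that(1)] that(2)
    unfolding always_satisfies_def fixed_rank_axiom_def w_def by metis
  have same: "w 2 j = w 4 j" if "j \<in> {1..2}" for j
  proof -
    have "\<forall>j'\<in>{1..j}. private_profile a 2 j' = private_profile a 4 j'"
      using that by (auto simp: private_profile_def)
    moreover have "j \<in> {1..4}"
      using that by auto
    ultimately show ?thesis
      using assms(2)[unfolded online_def, rule_format, OF valid[of 2] valid[of 4] that]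
      by (simp add: w_def)
  qed
  \<comment> \<open>At horizon 4 the threshold for \<open>l = 1\<close> is 4/4, so each singleton
    reaches it; at rank 1 its voter approves only \<open>a i\<close>.\<close>
  have "a i \<in> w 4 ` {1..4}" if i: "i \<in> {1..4}" for i
  proof -
    have "group 4 {i}"
      using i by (auto simp: group_def)
    moreover have "\<forall>j\<in>{1..4}. agrees (\<lambda>j i. top_set (private_profile a 4) j i 1) {i} j"
      using top_set_private_profile(1)[OF _ i, of _ 4 a] unfolding agrees_def by blast
    moreover have "real (card {i}) \<ge> real 1 * real 4 / real 4"
      by simp
    ultimately have "jr_guarantee 4 (\<lambda>j i. top_set (private_profile a 4) j i 1) (w 4) {i} 1"
      using wJR[of 4 1] unfolding wJR_def weak_axiom_def by simp
    then show ?thesis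
      using top_set_private_profile(1)[OF _ i, of _ 4 a]
      unfolding jr_guarantee_def represented_def by (metis imageI singletonD)
  qed
  then have "a ` {1..4} \<subseteq> w 4 ` {1..4}"
    by blast
  moreover have card_a: "card (a ` {1..4}) = 4"
    using a by (simp add: card_image inj_on_subset)
  \<comment> \<open>Four rounds leave no room for a winner beyond the four private candidates; in
    particular \<open>a 0\<close> never wins at horizon 4.\<close>
  moreover have "card (w 4 ` {1..4}) \<le> 4"
    using card_image_le[of "{1..4}" "w 4"] by simp
  ultimately have winners: "w 4 ` {1..4} = a ` {1..4}"
    by (metis card_seteq finite_atLeastAtMost finite_imageI)
  \<comment> \<open>These voters lack their private candidate among the first two winners. Two
    winners cover at most two of the four private candidates, so at least two voters remain.\<close>
  define S where "S = {i\<in>{1..4}. a i \<notin> w 4 ` {1..2}}"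
  have "card (w 4 ` {1..2}) \<le> 2"
    using card_image_le[of "{1..2}" "w 4"] by simp
  then have "2 \<le> card (a ` {1..4} - w 4 ` {1..2})"
    using diff_card_le_card_Diff[of "w 4 ` {1..2}" "a ` {1..4}"] card_a by simp
  also have "a ` {1..4} - w 4 ` {1..2} = a ` S"
    by (auto simp: S_def)
  also have "card (a ` S) = card S"
    using a by (simp add: card_image inj_on_subset)
  finally have card_S: "card S \<ge> 2" .
  have S: "i \<in> {1..4}" if "i \<in> S" for i
    using that by (simp add: S_def)
  have "group 4 S"
    using card_S S by (auto simp: group_def)
  moreover have "\<forall>j\<in>{1..2}. agrees (\<lambda>j i. top_set (private_profile a 2) j i 2) S j"
    using top_set_private_profile(2)[OF _ S, of _ 2 _ a] unfolding agrees_def by blast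
  \<comment> \<open>At horizon 2 the threshold for \<open>l = 1\<close> is 4/2, which two voters
    meet exactly.\<close>
  moreover have "real (card S) \<ge> real 1 * real 4 / real 2"
    using card_S by simp
  ultimately have "jr_guarantee 2 (\<lambda>j i. top_set (private_profile a 2) j i 2) (w 2) S 1"
    using wJR[of 2 2] unfolding wJR_def weak_axiom_def by simp
  then obtain i j where ij: "j \<in> {1..2}" "i \<in> S" "w 4 j \<in> {a i, a 0}"
    using top_set_private_profile(2)[OF _ S, of _ 2 _ a] same
    unfolding jr_guarantee_def represented_def by metis
  \<comment> \<open>The shared candidate \<open>a 0\<close> is excluded by the winners at horizon 4,
    although the violated guarantee concerns horizon 2.\<close>
  have "w 4 j \<in> a ` {1..4}"
    using ij(1) unfolding winners[symmetric] by auto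
  then have "w 4 j \<noteq> a 0"
    using a by (auto dest: injD)
  moreover have "w 4 j \<noteq> a i"
    using ij(1,2) unfolding S_def by (metis (no_types, lifting) CollectD imageI)
  ultimately show False
    using ij(3) by blast
qed

theorem theorem4p6:
  assumes "infinite (UNIV :: 'c set)"
  shows "(\<nexists>f :: 'c rule. temporal_voting_rule f \<and> online f \<and>
             always_satisfies f (fixed_rank_axiom wJR)) \<and>
         (\<forall>R \<in> {fixed_rank_axiom, rank_axiom, all_rank_axiom}. \<forall>X \<in> {wJR, JR, wPJR, PJR, wEJR, EJR}.
            \<nexists>f :: 'c rule. temporal_voting_rule f \<and> online f \<and> always_satisfies f (R X))"
proof (intro conjI ballI notI)
  assume "\<exists>f :: 'c rule. temporal_voting_rule f \<and> online f \<and>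
             always_satisfies f (fixed_rank_axiom wJR)"
  then show False
    using no_online_fixed_rank_wJR[OF assms] by blast
next
  fix R :: "'c approval_axiom \<Rightarrow> 'c temporal_axiom" and X :: "'c approval_axiom"
  assume RX: "R \<in> {fixed_rank_axiom, rank_axiom, all_rank_axiom}"
    "X \<in> {wJR, JR, wPJR, PJR, wEJR, EJR}"
  assume "\<exists>f :: 'c rule. temporal_voting_rule f \<and> online f \<and> always_satisfies f (R X)"
  then obtain f :: "'c rule" where f: "online f" "always_satisfies f (R X)"
    by blast
  have "always_satisfies f (fixed_rank_axiom wJR)"
    unfolding always_satisfies_def
  proof (intro allI impI)
    fix n T and C :: "'c set" and P
    assume valid: "valid_input n C T P"
    then show "fixed_rank_axiom wJR n C T P (f n C T P)"
      using fixed_rank_wJR_weakest[OF RX] f(2)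
      unfolding always_satisfies_def valid_input_def by blast
  qed
  then show False
    using no_online_fixed_rank_wJR[OF assms f(1)] by blast
qed

end
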